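(* Let $\Sigma=(\Gamma,\sigma)$ be a connected signed graph of order $n$ with vertices $v_1,\dots,v_n$. Then \[ \frac{2}{n}\sum_{j=1}^n d_j^- \le \lambda_{\max}(L(\Sigma)), \qquad \sqrt{\frac{4}{n}\sum_{j=1}^n (d_j^-)^2}\le \lambda_{\max}(L(\Sigma)), \] and \[ \frac{1}{n^{1/3}}\Big(4\sum_{j=1}^n d_j(d_j^-)^2-8\sum_{e_{ij}\in E(\Gamma)}\sigma(e_{ij})\,d_i^-d_j^-\Big)^{1/3}\le \lambda_{\max}(L(\Sigma)). \]
   Context: A signed graph $\Sigma=(\Gamma,\sigma)$ consists of a simple graph $\Gamma=(V,E)$, $V=\{v_1,\dots,v_n\}$, and a signature $\sigma:E\to\{+1,-1\}$; $e_{ij}$ denotes the edge $v_iv_j$. The adjacency matrix $A(\Sigma)=(a_{ij})$ has $a_{ij}=\sigma(e_{ij})$ if $v_i$ is adjacent to $v_j$ and $0$ otherwise. $D(\Sigma)$ is the diagonal matrix of vertex degrees $d_j=\deg(v_j)$, and the Laplacian is $L(\Sigma)=D(\Sigma)-A(\Sigma)$ (real symmetric positive semidefinite); $\lambda_{\max}(L(\Sigma))$ is its largest eigenvalue. $d_j^-$ denotes the number of negative edges incident to $v_j$. *)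

theory Defs
  imports "HOL-Analysis.Analysis"
begin

text \<open>
  The vertex set is the whole finite type \<open>'v\<close>, so the order of the graph is \<open>CARD('v)\<close> and
  matrices are indexed directly by vertices. Edges are two-element sets of vertices; a signature
  is only meaningful on the edges.
\<close>

definition signed_graph :: "'v set set \<Rightarrow> ('v set \<Rightarrow> real) \<Rightarrow> bool" where
  "signed_graph E \<sigma> \<longleftrightarrow> (\<forall>e\<in>E. card e = 2) \<and> (\<forall>e\<in>E. \<sigma> e \<in> {1, -1})"

definition connected_graph :: "'v set set \<Rightarrow> bool" where
  "connected_graph E \<longleftrightarrow> (\<forall>u v. (u, v) \<in> {(x, y). {x, y} \<in> E}\<^sup>*)"

definition vdegree :: "'v set set \<Rightarrow> 'v \<Rightarrow> nat" where
  "vdegree E v = card {e \<in> E. v \<in> e}"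

definition neg_degree :: "'v set set \<Rightarrow> ('v set \<Rightarrow> real) \<Rightarrow> 'v \<Rightarrow> nat" where
  "neg_degree E \<sigma> v = card {e \<in> E. v \<in> e \<and> \<sigma> e = -1}"

definition adjacency_matrix ::
    "'v::finite set set \<Rightarrow> ('v set \<Rightarrow> real) \<Rightarrow> real ^ 'v ^ 'v" where
  "adjacency_matrix E \<sigma> = (\<chi> i j. if {i, j} \<in> E then \<sigma> {i, j} else 0)"

definition degree_matrix :: "'v::finite set set \<Rightarrow> real ^ 'v ^ 'v" where
  "degree_matrix E = (\<chi> i j. if i = j then real (vdegree E i) else 0)"

definition laplacian ::
    "'v::finite set set \<Rightarrow> ('v set \<Rightarrow> real) \<Rightarrow> real ^ 'v ^ 'v" where
  "laplacian E \<sigma> = degree_matrix E - adjacency_matrix E \<sigma>"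

definition eigenvalues :: "real ^ 'n ^ 'n \<Rightarrow> real set" where
  "eigenvalues A = {c. \<exists>x. x \<noteq> 0 \<and> A *v x = c *\<^sub>R x}"

text \<open>
  Used only for real symmetric matrices, whose set of real eigenvalues is finite and nonempty,
  so that \<open>Max\<close> is a genuine maximum.
\<close>

definition lambda_max :: "real ^ 'n ^ 'n \<Rightarrow> real" where
  "lambda_max A = Max (eigenvalues A)"

end

theory Submission imports Defs
begin

text \<open>
  The all-ones vector satisfies \<open>L 1 = 2 d\<^sup>-\<close>, where \<open>d\<^sup>-\<close> is the vector of negative degrees. Hence the
  three quantities are, up to normalisation by \<open>n = 1 \<bullet> 1\<close>, the moments \<open>1 \<bullet> L 1\<close>, \<open>1 \<bullet> L\<^sup>2 1\<close> and
  \<open>1 \<bullet> L\<^sup>3 1\<close>. Rayleigh's principle bounds the first, and since \<open>L\<close> is positive semidefinite, the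
  Cauchy--Schwarz inequality for the form \<open>x \<bullet> L y\<close> gives the other two.
\<close>

section \<open>Positive semidefinite matrices as semi-inner products\<close>

text \<open>Symmetry is part of the notion because over the reals a nonnegative quadratic form does
  not force it.\<close>

definition psd_matrix :: "real ^ 'n ^ 'n \<Rightarrow> bool" where
  "psd_matrix A \<longleftrightarrow> transpose A = A \<and> (\<forall>x. 0 \<le> x \<bullet> (A *v x))"

lemma symmetric_matrix_inner:
  fixes A :: "real ^ 'n ^ 'n"
  assumes "transpose A = A"
  shows "x \<bullet> (A *v y) = (A *v x) \<bullet> y"
  by (metis assms dot_lmul_matrix transpose_matrix_vector)

text \<open>The form evaluated at \<open>x + t *\<^sub>R y\<close> is a polynomial in
  \<open>t\<close> of degree at most two that never becomes negative, so its discriminant is not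
  positive. The form may be degenerate, hence the separate case \<open>c = 0\<close>.\<close>

lemma psd_matrix_cauchy_schwarz:
  fixes A :: "real ^ 'n ^ 'n"
  assumes "psd_matrix A"
  shows "(x \<bullet> (A *v y))\<^sup>2 \<le> (x \<bullet> (A *v x)) * (y \<bullet> (A *v y))"
proof -
  have sym: "y \<bullet> (A *v x) = x \<bullet> (A *v y)"
    using assms by (metis psd_matrix_def symmetric_matrix_inner inner_commute)
  have quad: "0 \<le> x \<bullet> (A *v x) + 2 * t * (x \<bullet> (A *v y)) + t\<^sup>2 * (y \<bullet> (A *v y))" for t
  proof -
    have "0 \<le> (x + t *\<^sub>R y) \<bullet> (A *v (x + t *\<^sub>R y))"
      using assms by (simp add: psd_matrix_def)
    then show ?thesis
      by (simp add: matrix_vector_right_distrib matrix_vector_mult_scaleR inner_add_left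
          inner_add_right sym power2_eq_square algebra_simps)
  qed
  define a b c where "a = x \<bullet> (A *v x)" and "b = x \<bullet> (A *v y)" and "c = y \<bullet> (A *v y)"
  have q: "0 \<le> a + 2 * t * b + t\<^sup>2 * c" for t
    using quad[of t] by (simp add: a_def b_def c_def)
  have "0 \<le> c"
    using assms by (simp add: psd_matrix_def c_def)
  have "b\<^sup>2 \<le> a * c"
  proof (cases "c = 0")
    case True
    have "b = 0"
    proof (rule ccontr)
      assume "b \<noteq> 0"
      \<comment> \<open>With \<open>c = 0\<close> the polynomial is affine in \<open>t\<close>; this
        \<open>t\<close> is where it takes the value -1.\<close>
      then show False
        using q[of "- (a + 1) / (2 * b)"] True by (simp add: field_simps)
    qed
    then show ?thesis using True by simp
  next
    case False
    with \<open>0 \<le> c\<close> have "0 < c" by simp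
    \<comment> \<open>\<open>- b / c\<close> minimises the quadratic; the factor \<open>c\<close>
      clears the denominator.\<close>
    have "0 \<le> c * (a + 2 * (- b / c) * b + (- b / c)\<^sup>2 * c)"
      using q[of "- b / c"] \<open>0 < c\<close> by (intro mult_nonneg_nonneg) auto
    also have "\<dots> = a * c - b\<^sup>2"
      using \<open>0 < c\<close> by (simp add: field_simps power2_eq_square)
    finally show ?thesis by simp
  qed
  then show ?thesis by (simp add: a_def b_def c_def)
qed

text \<open>Cauchy-Schwarz for \<open>A *v x\<close> against \<open>x\<close> bounds the square of
  \<open>(A *v x) \<bullet> (A *v x)\<close> by 0. This later turns a maximiser of the Rayleigh
  quotient into an eigenvector.\<close>

lemma psd_matrix_isotropic_imp_kernel:
  fixes A :: "real ^ 'n ^ 'n"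
  assumes "psd_matrix A" and "x \<bullet> (A *v x) = 0"
  shows "A *v x = 0"
proof -
  have "((A *v x) \<bullet> (A *v x))\<^sup>2 \<le> 0"
    using psd_matrix_cauchy_schwarz[OF assms(1), of "A *v x" x] assms(2) by simp
  then show ?thesis by simp
qed

section \<open>The largest eigenvalue and Rayleigh's principle\<close>

lemma finite_eigenvalues_symmetric:
  fixes A :: "real ^ 'n ^ 'n"
  assumes "transpose A = A"
  shows "finite (eigenvalues A)"
proof -
  have "\<forall>c\<in>eigenvalues A. \<exists>x. x \<noteq> 0 \<and> A *v x = c *\<^sub>R x"
    by (auto simp: eigenvalues_def)
  then obtain f where f: "\<And>c. c \<in> eigenvalues A \<Longrightarrow> f c \<noteq> 0 \<and> A *v f c = c *\<^sub>R f c"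
    by metis
  \<comment> \<open>Moving \<open>A\<close> across the inner product gives
    \<open>d * (f c \<bullet> f d) = c * (f c \<bullet> f d)\<close>.\<close>
  have orth: "f c \<bullet> f d = 0" if "c \<in> eigenvalues A" "d \<in> eigenvalues A" "c \<noteq> d" for c d
    using symmetric_matrix_inner[OF assms, of "f c" "f d"] f[OF that(1)] f[OF that(2)] that(3)
    by simp
  \<comment> \<open>An eigenvector shared by two distinct eigenvalues would be orthogonal to itself,
    hence zero.\<close>
  have "inj_on f (eigenvalues A)"
    by (rule inj_onI) (metis orth f inner_eq_zero_iff)
  moreover have "finite (f ` eigenvalues A)"
    by (rule pairwise_orthogonal_imp_finite)
       (auto simp: pairwise_def orthogonal_def intro: orth)
  ultimately show ?thesis
    by (rule finite_imageD[rotated])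
qed

text \<open>The quadratic form attains a maximum \<open>m\<close> on the compact unit sphere, at
  some \<open>u\<close>. Then \<open>m\<close> times the identity, minus \<open>A\<close>, is
  positive semidefinite and isotropic at \<open>u\<close>, so it kills \<open>u\<close> and
  \<open>m\<close> is an eigenvalue. Neither the spectral theorem nor differentiation
  enters.\<close>

lemma rayleigh_le_lambda_max:
  fixes A :: "real ^ 'n ^ 'n"
  assumes sym: "transpose A = A"
  shows "x \<bullet> (A *v x) \<le> lambda_max A * (x \<bullet> x)"
proof -
  let ?S = "sphere (0 :: real ^ 'n) 1"
  have "continuous_on ?S (\<lambda>x. x \<bullet> (A *v x))"
    by (intro continuous_intros)
  moreover have "?S \<noteq> {}" by simp
  ultimately have "\<exists>u\<in>?S. \<forall>y\<in>?S. y \<bullet> (A *v y) \<le> u \<bullet> (A *v u)"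
    by (intro continuous_attains_sup compact_sphere)
  then obtain u where u: "u \<in> ?S" and
    max: "\<And>y. y \<in> ?S \<Longrightarrow> y \<bullet> (A *v y) \<le> u \<bullet> (A *v u)"
    by blast
  define m where "m = u \<bullet> (A *v u)"
  have le: "y \<bullet> (A *v y) \<le> m * (y \<bullet> y)" for y
  proof (cases "y = 0")
    case False
    then have "(y /\<^sub>R norm y) \<bullet> (A *v (y /\<^sub>R norm y)) \<le> m"
      unfolding m_def by (intro max) simp
    then show ?thesis
      using False by (simp add: matrix_vector_mult_scaleR field_simps dot_square_norm power2_eq_square)
  qed simp
  define B where "B = m *\<^sub>R mat 1 - A"
  have B: "B *v y = m *\<^sub>R y - A *v y" for y
    by (simp add: B_def matrix_vector_mult_diff_rdistrib scaleR_matrix_vector_assoc[symmetric])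
  have "transpose B = B"
    using sym by (simp add: B_def transpose_def vec_eq_iff mat_def)
  then have "psd_matrix B"
    using le by (simp add: psd_matrix_def B inner_diff_right)
  moreover have "u \<bullet> (B *v u) = 0"
    using u by (simp add: B inner_diff_right m_def dot_square_norm)
  ultimately have "B *v u = 0"
    by (rule psd_matrix_isotropic_imp_kernel)
  then have "m \<in> eigenvalues A"
    using u by (auto simp: eigenvalues_def B intro!: exI[of _ u])
  then have "m \<le> lambda_max A"
    unfolding lambda_max_def by (intro Max_ge finite_eigenvalues_symmetric sym)
  then show ?thesis
    by (meson le inner_ge_zero mult_right_mono order_trans)
qed

lemma psd_matrix_lambda_max_nonneg:
  fixes A :: "real ^ 'n ^ 'n"
  assumes "psd_matrix A"
  shows "0 \<le> lambda_max A"
proof -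
  obtain x :: "real ^ 'n" where "x \<noteq> 0"
    using nonzero_Basis nonempty_Basis by blast
  then have "0 < x \<bullet> x" by simp
  moreover have "0 \<le> lambda_max A * (x \<bullet> x)"
    using assms rayleigh_le_lambda_max[of A x] by (auto simp: psd_matrix_def intro: order_trans)
  ultimately show ?thesis
    by (metis linorder_not_le mult_neg_pos)
qed

section \<open>Higher moments of a positive semidefinite matrix\<close>

text \<open>Cauchy-Schwarz for the form at \<open>A *v x\<close> and \<open>x\<close>, with Rayleigh
  applied to both factors, gives the bound times an extra
  \<open>(A *v x) \<bullet> (A *v x)\<close>, which cancels. Semidefiniteness matters: a negative
  eigenvalue could exceed \<open>lambda_max A\<close> in absolute value.\<close>

lemma psd_matrix_second_moment_le:
  fixes A :: "real ^ 'n ^ 'n"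
  assumes "psd_matrix A"
  shows "(A *v x) \<bullet> (A *v x) \<le> (lambda_max A)\<^sup>2 * (x \<bullet> x)"
proof -
  let ?y = "A *v x" and ?l = "lambda_max A"
  have sym: "transpose A = A" and pos: "\<And>z. 0 \<le> z \<bullet> (A *v z)"
    using assms by (auto simp: psd_matrix_def)
  have "(?y \<bullet> ?y)\<^sup>2 \<le> (?y \<bullet> (A *v ?y)) * (x \<bullet> ?y)"
    using psd_matrix_cauchy_schwarz[OF assms] .
  also have "\<dots> \<le> (?l * (?y \<bullet> ?y)) * (?l * (x \<bullet> x))"
    using psd_matrix_lambda_max_nonneg[OF assms] pos
    by (intro mult_mono rayleigh_le_lambda_max sym) auto
  finally have "(?y \<bullet> ?y) * (?y \<bullet> ?y) \<le> (?y \<bullet> ?y) * (?l\<^sup>2 * (x \<bullet> x))"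
    by (simp add: power2_eq_square mult_ac)
  then show ?thesis
    by (cases "?y = 0") auto
qed

lemma psd_matrix_third_moment_le:
  fixes A :: "real ^ 'n ^ 'n"
  assumes "psd_matrix A"
  shows "(A *v x) \<bullet> (A *v (A *v x)) \<le> lambda_max A ^ 3 * (x \<bullet> x)"
proof -
  have "(A *v x) \<bullet> (A *v (A *v x)) \<le> lambda_max A * ((A *v x) \<bullet> (A *v x))"
    using assms by (intro rayleigh_le_lambda_max) (simp add: psd_matrix_def)
  also have "\<dots> \<le> lambda_max A * ((lambda_max A)\<^sup>2 * (x \<bullet> x))"
    by (intro mult_left_mono psd_matrix_second_moment_le psd_matrix_lambda_max_nonneg assms)
  finally show ?thesis
    by (simp add: power3_eq_cube power2_eq_square mult_ac)
qed

section \<open>Double counting of edges\<close>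

lemma sum_neighbours_eq_sum_incident_edges:
  fixes E :: "'v::finite set set" and f :: "'v set \<Rightarrow> 'a::comm_monoid_add"
  assumes "\<forall>e\<in>E. card e = 2"
  shows "(\<Sum>j\<in>UNIV. if {i, j} \<in> E then f {i, j} else 0) = (\<Sum>e | e \<in> E \<and> i \<in> e. f e)"
proof -
  have "inj_on (\<lambda>j. {i, j}) {j. {i, j} \<in> E}"
    by (auto simp: inj_on_def doubleton_eq_iff)
  \<comment> \<open>Surjectivity is where \<open>card e = 2\<close> enters: an edge through
    \<open>i\<close> has exactly one other endpoint.\<close>
  moreover have "(\<lambda>j. {i, j}) ` {j. {i, j} \<in> E} = {e \<in> E. i \<in> e}"
    using assms by (auto simp: image_iff) (metis card_2_iff insertE insert_commute singletonD)
  ultimately have "(\<Sum>e | e \<in> E \<and> i \<in> e. f e) = (\<Sum>j | {i, j} \<in> E. f {i, j})"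
    by (metis (no_types, lifting) sum.reindex_cong)
  then show ?thesis
    by (simp add: sum.If_cases)
qed

text \<open>Each edge is met once from each of its two endpoints.\<close>

lemma sum_adjacent_pairs_eq_sum_edges:
  fixes E :: "'v::finite set set" and f :: "'v set \<Rightarrow> real"
  assumes "\<forall>e\<in>E. card e = 2"
  shows "(\<Sum>i\<in>UNIV. \<Sum>j\<in>UNIV. if {i, j} \<in> E then f {i, j} else 0) = 2 * (\<Sum>e\<in>E. f e)"
proof -
  have "(\<Sum>i\<in>UNIV. \<Sum>j\<in>UNIV. if {i, j} \<in> E then f {i, j} else 0)
      = (\<Sum>i\<in>UNIV. \<Sum>e\<in>E. if i \<in> e then f e else 0)"
    by (simp add: sum_neighbours_eq_sum_incident_edges[OF assms] sum.inter_filter)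
  also have "\<dots> = (\<Sum>e\<in>E. \<Sum>i\<in>UNIV. if i \<in> e then f e else 0)"
    by (rule sum.swap)
  also have "\<dots> = (\<Sum>e\<in>E. 2 * f e)"
    using assms by (intro sum.cong) (simp_all add: sum.If_cases)
  finally show ?thesis
    by (simp add: sum_distrib_left)
qed

lemma vdegree_eq_sum:
  fixes E :: "'v::finite set set"
  assumes "\<forall>e\<in>E. card e = 2"
  shows "real (vdegree E i) = (\<Sum>j\<in>UNIV. if {i, j} \<in> E then 1 else 0)"
  using sum_neighbours_eq_sum_incident_edges[OF assms, where f = "\<lambda>_. 1 :: real"]
  by (simp add: vdegree_def)

text \<open>An incident edge contributes \<open>1 - \<sigma> e\<close>, which is 0 if it is positive
  and 2 if it is negative. The left side is a row sum of the Laplacian.\<close>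

lemma vdegree_minus_sum_signs:
  fixes E :: "'v::finite set set"
  assumes "signed_graph E \<sigma>"
  shows "real (vdegree E i) - (\<Sum>j\<in>UNIV. if {i, j} \<in> E then \<sigma> {i, j} else 0)
      = 2 * real (neg_degree E \<sigma> i)"
proof -
  have c2: "\<forall>e\<in>E. card e = 2" and sgn: "\<And>e. e \<in> E \<Longrightarrow> \<sigma> e = 1 \<or> \<sigma> e = -1"
    using assms by (auto simp: signed_graph_def)
  have "real (vdegree E i) - (\<Sum>j\<in>UNIV. if {i, j} \<in> E then \<sigma> {i, j} else 0)
      = (\<Sum>e | e \<in> E \<and> i \<in> e. 1 - \<sigma> e)"
    by (simp add: sum_neighbours_eq_sum_incident_edges[OF c2] vdegree_def sum_subtractf)
  also have "\<dots> = (\<Sum>e | e \<in> E \<and> i \<in> e. if \<sigma> e = -1 then 2 else 0)"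
    by (intro sum.cong) (auto dest: sgn)
  also have "\<dots> = 2 * real (neg_degree E \<sigma> i)"
    by (simp add: sum.If_cases neg_degree_def Int_def conj_ac)
  finally show ?thesis .
qed

section \<open>The Laplacian and its quadratic form\<close>

lemma laplacian_mult_component:
  fixes E :: "'v::finite set set" and x :: "real ^ 'v"
  shows "(laplacian E \<sigma> *v x) $ i
    = real (vdegree E i) * x $ i - (\<Sum>j\<in>UNIV. if {i, j} \<in> E then \<sigma> {i, j} * x $ j else 0)"
proof -
  have "(laplacian E \<sigma> *v x) $ i = (\<Sum>j\<in>UNIV. (if i = j then real (vdegree E i) * x $ j else 0)
      - (if {i, j} \<in> E then \<sigma> {i, j} * x $ j else 0))"
    unfolding matrix_vector_mult_def
    by (auto simp: laplacian_def degree_matrix_def adjacency_matrix_def algebra_simps intro!: sum.cong)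
  then show ?thesis
    by (simp add: sum_subtractf)
qed

lemma laplacian_mult_one:
  fixes E :: "'v::finite set set"
  assumes "signed_graph E \<sigma>"
  shows "laplacian E \<sigma> *v 1 = (\<chi> i. 2 * real (neg_degree E \<sigma> i))"
  using vdegree_minus_sum_signs[OF assms]
  by (simp add: vec_eq_iff laplacian_mult_component cong: if_cong)

lemma laplacian_quadratic_form:
  fixes E :: "'v::finite set set" and x :: "real ^ 'v"
  shows "x \<bullet> (laplacian E \<sigma> *v x) = (\<Sum>i\<in>UNIV. real (vdegree E i) * (x $ i)\<^sup>2)
    - (\<Sum>i\<in>UNIV. \<Sum>j\<in>UNIV. if {i, j} \<in> E then \<sigma> {i, j} * (x $ i * x $ j) else 0)"
proof -
  have "x $ i * (laplacian E \<sigma> *v x) $ i = real (vdegree E i) * (x $ i)\<^sup>2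
      - (\<Sum>j\<in>UNIV. if {i, j} \<in> E then \<sigma> {i, j} * (x $ i * x $ j) else 0)" for i
    by (auto simp: laplacian_mult_component right_diff_distrib sum_distrib_left power2_eq_square
        intro!: sum.cong)
  then show ?thesis
    by (simp add: inner_vec_def sum_subtractf)
qed

lemma transpose_laplacian: "transpose (laplacian E \<sigma>) = laplacian E \<sigma>"
  by (auto simp: laplacian_def transpose_def degree_matrix_def adjacency_matrix_def vec_eq_iff
      insert_commute)

text \<open>This exhibits semidefiniteness. Summing over ordered pairs avoids orienting the edges,
  at the price of the factor 2.\<close>

lemma laplacian_quadratic_form_sum_squares:
  fixes E :: "'v::finite set set" and x :: "real ^ 'v"
  assumes "signed_graph E \<sigma>"
  shows "2 * (x \<bullet> (laplacian E \<sigma> *v x))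
    = (\<Sum>i\<in>UNIV. \<Sum>j\<in>UNIV. if {i, j} \<in> E then (x $ i - \<sigma> {i, j} * x $ j)\<^sup>2 else 0)"
proof -
  have c2: "\<forall>e\<in>E. card e = 2" and sgn: "\<And>e. e \<in> E \<Longrightarrow> (\<sigma> e)\<^sup>2 = 1"
    using assms by (auto simp: signed_graph_def)
  have deg: "(\<Sum>i\<in>UNIV. real (vdegree E i) * (x $ i)\<^sup>2)
      = (\<Sum>i\<in>UNIV. \<Sum>j\<in>UNIV. if {i, j} \<in> E then (x $ i)\<^sup>2 else 0)"
    by (simp add: vdegree_eq_sum[OF c2] sum_distrib_right if_distrib[of "\<lambda>t. t * _"] cong: if_cong)
  \<comment> \<open>Exchanging the endpoints shows that the degree term supplies both squares in
    each expanded \<open>(x $ i - \<sigma> {i, j} * x $ j)\<^sup>2\<close>, where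
    \<open>(\<sigma> {i, j})\<^sup>2 = 1\<close>.\<close>
  also have deg': "\<dots> = (\<Sum>i\<in>UNIV. \<Sum>j\<in>UNIV. if {i, j} \<in> E then (x $ j)\<^sup>2 else 0)"
    by (subst sum.swap) (simp add: insert_commute)
  have "(\<Sum>i\<in>UNIV. \<Sum>j\<in>UNIV. if {i, j} \<in> E then (x $ i - \<sigma> {i, j} * x $ j)\<^sup>2 else 0)
      = (\<Sum>i\<in>UNIV. \<Sum>j\<in>UNIV. (if {i, j} \<in> E then (x $ i)\<^sup>2 else 0)
          + (if {i, j} \<in> E then (x $ j)\<^sup>2 else 0)
          - 2 * (if {i, j} \<in> E then \<sigma> {i, j} * (x $ i * x $ j) else 0))"
    by (intro sum.cong) (auto simp: power2_diff power_mult_distrib sgn)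
  then show ?thesis
    by (simp add: sum_subtractf sum.distrib laplacian_quadratic_form deg deg'
        flip: sum_distrib_left)
qed

lemma psd_matrix_laplacian:
  assumes "signed_graph E \<sigma>"
  shows "psd_matrix (laplacian E \<sigma>)"
  unfolding psd_matrix_def
proof (intro conjI allI transpose_laplacian)
  fix x
  have "0 \<le> 2 * (x \<bullet> (laplacian E \<sigma> *v x))"
    unfolding laplacian_quadratic_form_sum_squares[OF assms] by (intro sum_nonneg) auto
  then show "0 \<le> x \<bullet> (laplacian E \<sigma> *v x)" by simp
qed

text \<open>Edges are unordered sets, so the product of the two endpoint values is written as a
  product over the edge.\<close>

lemma laplacian_quadratic_form_edges:
  fixes E :: "'v::finite set set" and x :: "real ^ 'v"
  assumes "signed_graph E \<sigma>"
  shows "x \<bullet> (laplacian E \<sigma> *v x)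
    = (\<Sum>i\<in>UNIV. real (vdegree E i) * (x $ i)\<^sup>2) - 2 * (\<Sum>e\<in>E. \<sigma> e * (\<Prod>v\<in>e. x $ v))"
proof -
  have c2: "\<forall>e\<in>E. card e = 2"
    using assms by (simp add: signed_graph_def)
  \<comment> \<open>The case \<open>i = j\<close> is excluded by \<open>card e = 2\<close>; there
    the product over \<open>{i, j}\<close> would have a single factor.\<close>
  have "x $ i * x $ j = (\<Prod>v\<in>{i, j}. x $ v)" if "{i, j} \<in> E" for i j
    using c2 that by (cases "i = j") auto
  then show ?thesis
    by (simp add: laplacian_quadratic_form cong: if_cong
        flip: sum_adjacent_pairs_eq_sum_edges[OF c2])
qed

theorem theorem3p1:
  fixes E :: "'v::finite set set" and \<sigma> :: "'v set \<Rightarrow> real"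
  assumes "signed_graph E \<sigma>" and "connected_graph E"
  shows "2 / real CARD('v) * (\<Sum>v\<in>UNIV. real (neg_degree E \<sigma> v))
           \<le> lambda_max (laplacian E \<sigma>)
       \<and> sqrt (4 / real CARD('v) * (\<Sum>v\<in>UNIV. (real (neg_degree E \<sigma> v))\<^sup>2))
           \<le> lambda_max (laplacian E \<sigma>)
       \<and> 1 / root 3 (real CARD('v)) *
           root 3 (4 * (\<Sum>v\<in>UNIV. real (vdegree E v) * (real (neg_degree E \<sigma> v))\<^sup>2)
                   - 8 * (\<Sum>e\<in>E. \<sigma> e * (\<Prod>v\<in>e. real (neg_degree E \<sigma> v))))
           \<le> lambda_max (laplacian E \<sigma>)"
proof -
  let ?L = "laplacian E \<sigma>" and ?n = "real CARD('v)"
  let ?l = "lambda_max ?L"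
  define d where "d v = real (neg_degree E \<sigma> v)" for v
  have psd: "psd_matrix ?L"
    by (rule psd_matrix_laplacian[OF assms(1)])
  have L1: "?L *v 1 = (\<chi> v. 2 * d v)"
    by (simp add: laplacian_mult_one[OF assms(1)] d_def)
  have n: "(1 :: real ^ 'v) \<bullet> 1 = ?n"
    by (simp add: inner_vec_def)
  have l0: "0 \<le> ?l"
    by (rule psd_matrix_lambda_max_nonneg[OF psd])
  have "2 * (\<Sum>v\<in>UNIV. d v) = 1 \<bullet> (?L *v 1)"
    by (simp add: L1 inner_vec_def sum_distrib_left)
  also have "\<dots> \<le> ?l * ?n"
    using rayleigh_le_lambda_max[of ?L 1] transpose_laplacian[of E \<sigma>] by (simp add: n)
  finally have first: "2 / ?n * (\<Sum>v\<in>UNIV. d v) \<le> ?l"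
    by (simp add: field_simps)
  have "4 * (\<Sum>v\<in>UNIV. (d v)\<^sup>2) = (?L *v 1) \<bullet> (?L *v 1)"
    by (simp add: L1 inner_vec_def sum_distrib_left power2_eq_square mult_ac)
  also have "\<dots> \<le> ?l\<^sup>2 * ?n"
    using psd_matrix_second_moment_le[OF psd, of 1] by (simp add: n)
  finally have "4 / ?n * (\<Sum>v\<in>UNIV. (d v)\<^sup>2) \<le> ?l\<^sup>2"
    by (simp add: field_simps)
  then have second: "sqrt (4 / ?n * (\<Sum>v\<in>UNIV. (d v)\<^sup>2)) \<le> ?l"
    using l0 by (rule real_le_lsqrt[rotated])
  let ?T = "4 * (\<Sum>v\<in>UNIV. real (vdegree E v) * (d v)\<^sup>2) - 8 * (\<Sum>e\<in>E. \<sigma> e * (\<Prod>v\<in>e. d v))"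
  \<comment> \<open>Two endpoints per edge turn the 2 into 4; with the 2 of the edge formula this
    yields the coefficient 8.\<close>
  have "(\<Sum>e\<in>E. \<sigma> e * (\<Prod>v\<in>e. 2 * d v)) = (\<Sum>e\<in>E. 4 * (\<sigma> e * (\<Prod>v\<in>e. d v)))"
    using assms(1) by (intro sum.cong) (auto simp: signed_graph_def prod.distrib)
  \<comment> \<open>The third moment of the all-ones vector is the quadratic form at
    \<open>?L *v 1\<close>, that is, at twice the vector of negative degrees.\<close>
  then have "?T = (?L *v 1) \<bullet> (?L *v (?L *v 1))"
    unfolding laplacian_quadratic_form_edges[OF assms(1)]
    by (simp add: L1 power_mult_distrib sum_distrib_left mult_ac)
  also have "\<dots> \<le> ?l ^ 3 * ?n"
    using psd_matrix_third_moment_le[OF psd, of 1] by (simp add: n)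
  \<comment> \<open>An odd root is monotone on all reals, so no sign of \<open>?T\<close> has to be
    checked.\<close>
  finally have "root 3 ?T \<le> root 3 (?l ^ 3 * ?n)"
    by simp
  also have "\<dots> = ?l * root 3 ?n"
    using l0 by (simp add: real_root_mult real_root_power_cancel)
  finally have "1 / root 3 ?n * root 3 ?T \<le> ?l"
    by (simp add: field_simps)
  with first second show ?thesis
    by (simp add: d_def)
qed

end
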